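(* The following statements are equivalent: (A) WSCH (the Weak Singular Cardinals Hypothesis): for every singular cardinal $\kappa$ of uncountable cofinality, if $\kappa$ is a strong limit cardinal, then there are only finitely many cardinal numbers between $\kappa$ and $2^{\kappa}$. (B) For every singular strong limit cardinal $\kappa$ of uncountable cofinality and every $T_1$-topology $\tau$ on $\kappa$ such that $(\kappa,\tau)$ has no isolated points, player TWO has a winning coding strategy in the game $\mathrm{RG}(J)$, where $J$ is the ideal of nowhere dense subsets of $(\kappa,\tau)$.
   Context: Let $(X,\tau)$ be a $T_1$ topological space without isolated points, let $J$ be the ideal of nowhere dense subsets of $X$, and let $\langle J\rangle$ be the collection of meager subsets of $X$ (countable unions of nowhere dense sets). The game $\mathrm{RG}(J)$: players ONE and TWO play one inning for each positive integer $k$. In inning $k$, ONE first chooses a meager set $M_k\in\langle J\rangle$ (with no further constraints on ONE's moves), and then TWO responds with a nowhere dense set $N_k\in J$. TWO wins the play $(M_1,N_1,M_2,N_2,\ldots)$ if $\bigcup_{k=1}^{\infty}M_k\subseteq\bigcup_{k=1}^{\infty}N_k$; otherwise ONE wins. A coding strategy for TWO is a function $F$ with values in $J$, defined on $\langle J\rangle\cup(J\times\langle J\rangle)$, according to which TWO plays $N_1=F(M_1)$ and $N_{k+1}=F(N_k,M_{k+1})$ for all $k\ge 1$. It is a winning coding strategy if TWO wins every play in which TWO's moves are determined by $F$ in this way, i.e. for every sequence $(M_k)_{k\ge1}$ of meager sets, the sets $N_k$ so defined satisfy $\bigcup_{k}M_k\subseteq\bigcup_{k}N_k$. The underlying set theory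 is ZFC. *)

theory Defs
  imports "HOL-Analysis.Analysis"
begin

unbundle cardinal_syntax

text \<open>
  Following the library, a cardinal is a well-order relation satisfying \<^const>\<open>Card_order\<close>;
  cardinals on possibly different types are compared by \<open><o\<close>, \<open>\<le>o\<close> and \<open>=o\<close>, and equality
  of cardinals is \<open>=o\<close>.  Every cardinal below a cardinal \<open>\<kappa>\<close> on \<open>'a\<close> is represented on \<open>'a\<close>.
\<close>

text \<open>The least cardinality of a cofinal subset, determined up to \<open>=o\<close>
  (see \<open>cofinality_cofinal\<close> and \<open>cofinality_least\<close> below).\<close>

definition cofinality :: "'a rel \<Rightarrow> 'a rel" where
  "cofinality \<kappa> = (SOME \<mu>. (\<exists>K \<subseteq> Field \<kappa>. cofinal K \<kappa> \<and> \<mu> = |K| ) \<and>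
                          (\<forall>K \<subseteq> Field \<kappa>. cofinal K \<kappa> \<longrightarrow> \<mu> \<le>o |K| ))"

definition singular_cardinal :: "'a rel \<Rightarrow> bool" where
  "singular_cardinal \<kappa> \<longleftrightarrow> Cinfinite \<kappa> \<and> \<not> regularCard \<kappa>"

definition strong_limit_cardinal :: "'a rel \<Rightarrow> bool" where
  "strong_limit_cardinal \<kappa> \<longleftrightarrow>
     Cinfinite \<kappa> \<and> (\<forall>\<mu> :: 'a rel. Card_order \<mu> \<and> \<mu> <o \<kappa> \<longrightarrow> ctwo ^c \<mu> <o \<kappa>)"

text \<open>Since \<open>2\<^sup>\<kappa>\<close> lives on \<open>'a \<Rightarrow> bool\<close>, so do all cardinals below it; those between
  \<open>\<kappa>\<close> and \<open>2\<^sup>\<kappa>\<close> are counted modulo \<^const>\<open>ordIso\<close>.\<close>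

definition cardinals_between_power :: "'a rel \<Rightarrow> ('a \<Rightarrow> bool) rel set" where
  "cardinals_between_power \<kappa> = {\<mu>. Card_order \<mu> \<and> \<kappa> <o \<mu> \<and> \<mu> <o ctwo ^c \<kappa>}"

definition finitely_many_cardinals_between_power :: "'a rel \<Rightarrow> bool" where
  "finitely_many_cardinals_between_power \<kappa> \<longleftrightarrow>
     finite (cardinals_between_power \<kappa> // ordIso)"

lemma cofinality_spec:
  assumes "Cinfinite \<kappa>"
  shows "(\<exists>K \<subseteq> Field \<kappa>. cofinal K \<kappa> \<and> cofinality \<kappa> = |K| ) \<and>
         (\<forall>K \<subseteq> Field \<kappa>. cofinal K \<kappa> \<longrightarrow> cofinality \<kappa> \<le>o |K| )"
proof -
  let ?R = "card_of ` {K. K \<subseteq> Field \<kappa> \<and> cofinal K \<kappa>}"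
  have "cofinal (Field \<kappa>) \<kappa>"
    using assms unfolding cofinal_def cinfinite_def by (auto intro: infinite_Card_order_limit)
  then have ne: "?R \<noteq> {}" by blast
  have wo: "\<forall>r \<in> ?R. Well_order r" by (simp add: card_of_Well_order)
  obtain \<mu> where \<mu>: "\<mu> \<in> ?R" "\<forall>r \<in> ?R. \<mu> \<le>o r"
    using exists_minim_Well_order[OF ne wo] by (rule bexE)
  from \<mu>(1) obtain K where K: "K \<subseteq> Field \<kappa>" "cofinal K \<kappa>" "\<mu> = |K|" by auto
  have "(\<exists>K \<subseteq> Field \<kappa>. cofinal K \<kappa> \<and> \<mu> = |K| ) \<and>
        (\<forall>K \<subseteq> Field \<kappa>. cofinal K \<kappa> \<longrightarrow> \<mu> \<le>o |K| )"
  proof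
    show "\<exists>K \<subseteq> Field \<kappa>. cofinal K \<kappa> \<and> \<mu> = |K|" using K by metis
    show "\<forall>K \<subseteq> Field \<kappa>. cofinal K \<kappa> \<longrightarrow> \<mu> \<le>o |K|" using \<mu>(2) by simp
  qed
  then show ?thesis unfolding cofinality_def by (rule someI)
qed

lemma cofinality_cofinal:
  assumes "Cinfinite \<kappa>"
  obtains K where "K \<subseteq> Field \<kappa>" "cofinal K \<kappa>" "cofinality \<kappa> = |K|"
  using cofinality_spec[OF assms] by metis

lemma cofinality_least:
  "Cinfinite \<kappa> \<Longrightarrow> K \<subseteq> Field \<kappa> \<Longrightarrow> cofinal K \<kappa> \<Longrightarrow> cofinality \<kappa> \<le>o |K|"
  using cofinality_spec by metis

lemma singular_cardinal_iff_cofinality: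
  "singular_cardinal \<kappa> \<longleftrightarrow> Cinfinite \<kappa> \<and> cofinality \<kappa> <o \<kappa>"
proof (cases "Cinfinite \<kappa>")
  case True
  then have co: "Card_order \<kappa>" by simp
  have le: "|K| \<le>o \<kappa>" if "K \<subseteq> Field \<kappa>" for K
    by (rule ordLeq_ordIso_trans[OF card_of_mono1[OF that] card_of_Field_ordIso[OF co]])
  obtain K where K: "K \<subseteq> Field \<kappa>" "cofinal K \<kappa>" "cofinality \<kappa> = |K|"
    using cofinality_cofinal[OF True] .
  have "\<not> regularCard \<kappa> \<longleftrightarrow> cofinality \<kappa> <o \<kappa>"
  proof
    assume "\<not> regularCard \<kappa>"
    then obtain L where L: "L \<subseteq> Field \<kappa>" "cofinal L \<kappa>" "\<not> |L| =o \<kappa>"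
      unfolding regularCard_def by auto
    have "|L| <o \<kappa>" using le[OF L(1)] L(3) ordLeq_iff_ordLess_or_ordIso by metis
    then show "cofinality \<kappa> <o \<kappa>"
      by (rule ordLeq_ordLess_trans[OF cofinality_least[OF True L(1,2)]])
  next
    assume "cofinality \<kappa> <o \<kappa>"
    then have "\<not> |K| =o \<kappa>" unfolding K(3) by (rule not_ordLess_ordIso)
    then show "\<not> regularCard \<kappa>" using K(1,2) unfolding regularCard_def by auto
  qed
  then show ?thesis using True unfolding singular_cardinal_def by simp
next
  case False
  then show ?thesis unfolding singular_cardinal_def by auto
qed

definition nowhere_dense_sets :: "'a topology \<Rightarrow> 'a set set" where
  "nowhere_dense_sets X = {N. N \<subseteq> topspace X \<and> X interior_of (X closure_of N) = {}}"

definition no_isolated_points :: "'a topology \<Rightarrow> bool" where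
  "no_isolated_points X \<longleftrightarrow> (\<forall>x \<in> topspace X. \<not> openin X {x})"

definition countable_unions :: "'a set set \<Rightarrow> 'a set set" where
  "countable_unions J = {\<Union>\<C> | \<C>. countable \<C> \<and> \<C> \<subseteq> J}"

text \<open>
  For \<open>J\<close> the nowhere dense sets, \<open>countable_unions J\<close> is the collection of meager sets.
  A coding strategy has the disjoint union \<open>\<langle>J\<rangle> <+> (J \<times> \<langle>J\<rangle>)\<close> as its domain: \<open>F (Inl M)\<close> is the
  first move of TWO, and \<open>F (Inr (N, M))\<close> is the move after TWO's previous move \<open>N\<close> and ONE's
  current move \<open>M\<close>.  Innings are numbered from 0.
\<close>

type_synonym 'a coding = "'a set + 'a set \<times> 'a set \<Rightarrow> 'a set"

definition coding_strategy :: "'a set set \<Rightarrow> 'a coding \<Rightarrow> bool" where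
  "coding_strategy J F \<longleftrightarrow> F \<in> countable_unions J <+> (J \<times> countable_unions J) \<rightarrow> J"

primrec coding_move :: "'a coding \<Rightarrow> (nat \<Rightarrow> 'a set) \<Rightarrow> nat \<Rightarrow> 'a set" where
  "coding_move F M 0 = F (Inl (M 0))"
| "coding_move F M (Suc k) = F (Inr (coding_move F M k, M (Suc k)))"

definition winning_coding_strategy :: "'a set set \<Rightarrow> 'a coding \<Rightarrow> bool" where
  "winning_coding_strategy J F \<longleftrightarrow>
     coding_strategy J F \<and>
     (\<forall>M. (\<forall>k. M k \<in> countable_unions J) \<longrightarrow> (\<Union>k. M k) \<subseteq> (\<Union>k. coding_move F M k))"

end

theory Submission
  imports Defs
begin

no_notation Set_Algebras.elt_set_eq (infix \<open>=o\<close> 50)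

text \<open>
  If TWO has a winning coding strategy, then \<open>\<langle>J\<rangle>\<close> has a cofinal subfamily of size at most \<open>|J|\<close>.
  Conversely \<open>|\<langle>J\<rangle>| \<le> |J|\<close> suffices for TWO: every \<open>A \<in> J\<close> is a union of two sets each having \<open>|J|\<close>
  supersets in \<open>J\<close>, so TWO can cover one piece of a previous move of ONE while coding the whole
  history of the play by the choice of the superset.

  Under WSCH every cardinal \<open>\<lambda>\<close> from \<open>\<kappa>\<close> to \<open>2\<^sup>\<kappa>\<close> satisfies \<open>\<lambda>\<^sup>\<omega> = \<lambda>\<close>, because a least exception would
  have countable cofinality and hence infinitely many cardinals between it and \<open>\<kappa>\<close>; applied to
  \<open>\<lambda> = |J|\<close> this gives \<open>|\<langle>J\<rangle>| \<le> |J|\<close>. If WSCH fails at \<open>\<kappa>\<close>, let \<open>\<lambda> \<le> 2\<^sup>\<kappa>\<close> be the limit of an increasing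
  sequence of cardinals above \<open>\<kappa>\<close>, and let \<open>J\<close> be generated by \<open>\<lambda>\<close> many almost disjoint sets of size
  \<open>cf \<kappa>\<close> and the finite sets. Then \<open>|J| \<le> \<lambda>\<close>, but \<open>\<langle>J\<rangle>\<close> has no cofinal subfamily of size \<open>\<lambda>\<close>, since
  \<open>\<lambda>\<close> has countable cofinality.
\<close>

section \<open>Cardinal arithmetic\<close>

text \<open>This bounds the number of histories of ONE's moves that TWO has to encode and, through
  \<open>Fpow\<close>, the number of finite sets that generate the ideal of the
  counterexample.\<close>

lemma card_of_lists_infinite:
  assumes "infinite A"
  shows "|lists A| \<le>o |A|"
proof -
  have c: "Cinfinite |A|"
    using assms by (simp add: cinfinite_def Field_card_of card_of_card_order_on)
  have len: "|{xs \<in> lists A. length xs = n}| \<le>o |A|" for n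
  proof (induction n)
    case 0
    have "{xs \<in> lists A. length xs = 0} = {[]}" by auto
    moreover have "A \<noteq> {}" using assms by auto
    ultimately show ?case by (simp add: card_of_singl_ordLeq)
  next
    case (Suc n)
    have "{xs \<in> lists A. length xs = Suc n} \<subseteq> (\<Union>a\<in>A. (#) a ` {xs \<in> lists A. length xs = n})"
      by (force simp: length_Suc_conv)
    moreover have "|\<Union>a\<in>A. (#) a ` {xs \<in> lists A. length xs = n}| \<le>o |A|"
      using ordLeq_transitive[OF card_of_image Suc]
      by (intro UNION_Cinfinite_bound[OF _ _ c] ballI) (auto simp: ordLeq_refl card_of_Card_order)
    ultimately show ?case by (rule ordLeq_transitive[OF card_of_mono1])
  qed
  have "|\<Union>n. {xs \<in> lists A. length xs = n}| \<le>o |A|"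
    using len assms by (intro UNION_Cinfinite_bound[OF _ _ c]) (auto simp: infinite_iff_card_of_nat)
  moreover have "(\<Union>n. {xs \<in> lists A. length xs = n}) = lists A" by auto
  ultimately show ?thesis by simp
qed

lemma card_of_Fpow_infinite:
  assumes "infinite A"
  shows "|Fpow A| \<le>o |A|"
proof -
  have "Fpow A \<subseteq> set ` lists A"
    unfolding Fpow_def using finite_list by (fastforce simp: lists_eq_set)
  then show ?thesis
    using ordLeq_transitive[OF card_of_mono1] ordLeq_transitive[OF card_of_image]
      card_of_lists_infinite[OF assms] by metis
qed

text \<open>Transfinite recursion along the well-order \<open>|I|\<close>: as it is a cardinal,
  fewer than \<open>|I|\<close> values are used before stage \<open>i\<close>, so \<open>S i\<close>
  still offers a new one.\<close>

lemma injective_choice: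
  assumes "\<And>i. i \<in> I \<Longrightarrow> |I| \<le>o |S i|"
  obtains c where "inj_on c I" "\<And>i. i \<in> I \<Longrightarrow> c i \<in> S i"
proof -
  let ?r = "|I|"
  have r: "Well_order ?r" "Card_order ?r" "Field ?r = I"
    by (rule card_of_Well_order card_of_Card_order Field_card_of)+
  have wf: "wf (?r - Id)" using r(1) by (simp add: well_order_on_def)
  define P where "P f i x \<longleftrightarrow> i \<in> I \<longrightarrow> x \<in> S i - f ` underS ?r i" for f i x
  have "\<exists>c. \<forall>i. P c i (c i)"
  proof (rule dependent_wf_choice[OF wf])
    fix f g :: "'a \<Rightarrow> 'b" and i x
    assume "\<And>z. (z, i) \<in> ?r - Id \<Longrightarrow> f z = g z"
    then have "f ` underS ?r i = g ` underS ?r i"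
      unfolding underS_def by (intro image_cong) auto
    then show "P f i x = P g i x" unfolding P_def by simp
  next
    fix i and f :: "'a \<Rightarrow> 'b"
    have "S i - f ` underS ?r i \<noteq> {}" if i: "i \<in> I"
    proof
      assume "S i - f ` underS ?r i = {}"
      then have "|S i| \<le>o |f ` underS ?r i|" by (intro card_of_mono1) auto
      also have "|f ` underS ?r i| \<le>o |underS ?r i|" by (rule card_of_image)
      also have "|underS ?r i| <o |I|" using card_of_underS[OF r(2)] r(3) i by simp
      also have "|I| \<le>o |S i|" using assms[OF i] .
      finally show False using ordLess_irreflexive by auto
    qed
    then show "\<exists>x. P f i x" unfolding P_def by blast
  qed
  then obtain c where c: "\<And>i. i \<in> I \<Longrightarrow> c i \<in> S i - c ` underS ?r i"
    unfolding P_def by blast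
  have "inj_on c I"
  proof (rule inj_onI, rule ccontr)
    fix i j assume ij: "i \<in> I" "j \<in> I" "c i = c j" "i \<noteq> j"
    have "total_on I ?r" using card_of_well_order_on[of I]
      by (simp add: well_order_on_def linear_order_on_def)
    then have "i \<in> underS ?r j \<or> j \<in> underS ?r i"
      using ij unfolding underS_def total_on_def by auto
    then show False using c[OF ij(1)] c[OF ij(2)] ij(3) by (metis DiffE imageI)
  qed
  then show ?thesis using that c by blast
qed

lemma infinite_split_halves:
  assumes "infinite A"
  obtains B C where "A = B \<union> C" "B \<inter> C = {}" "|A| \<le>o |B|" "|A| \<le>o |C|"
proof -
  have "|A <+> A| =o |A|"
    using card_of_Plus_infinite1[OF assms] ordLeq_refl[OF card_of_Card_order] by blast
  then obtain f where f: "bij_betw f (A <+> A) A" using card_of_ordIso by blast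
  have inj: "inj_on f (A <+> A)" and im: "f ` (A <+> A) = A"
    using f by (auto simp: bij_betw_def)
  let ?B = "f ` Inl ` A" and ?C = "f ` Inr ` A"
  have "A = ?B \<union> ?C" using im by (simp add: Plus_def image_Un)
  moreover have "?B \<inter> ?C = {}" using inj by (fastforce dest: inj_onD)
  moreover have "|A| \<le>o |?B|" "|A| \<le>o |?C|"
    by (rule card_of_ordLeqI[of "f \<circ> Inl"]; use inj in \<open>fastforce simp: inj_on_def\<close>)
       (rule card_of_ordLeqI[of "f \<circ> Inr"]; use inj in \<open>fastforce simp: inj_on_def\<close>)
  ultimately show ?thesis by (rule that)
qed

lemma card_of_countable_unions:
  assumes "{} \<in> J"
  shows "|countable_unions J| \<le>o |J| ^c natLeq"
proof -
  have "countable_unions J \<subseteq> (\<lambda>f. \<Union>(range f)) ` Func (UNIV :: nat set) J"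
  proof
    fix M assume "M \<in> countable_unions J"
    then obtain \<C> where C: "countable \<C>" "\<C> \<subseteq> J" "M = \<Union>\<C>"
      unfolding countable_unions_def by auto
    \<comment> \<open>Adding \<open>{}\<close> makes the family nonempty, so that
      \<open>from_nat_into\<close> enumerates exactly it; the union does not change.\<close>
    have r: "range (from_nat_into (insert {} \<C>)) = insert {} \<C>"
      using C(1) by (intro range_from_nat_into) auto
    then have "\<forall>n. from_nat_into (insert {} \<C>) n \<in> J"
      using C(2) assms by (metis insert_subset rangeI subsetD)
    then have "from_nat_into (insert {} \<C>) \<in> Func UNIV J"
      unfolding Func_def by auto
    moreover have "M = \<Union>(range (from_nat_into (insert {} \<C>)))" using r C(3) by simp
    ultimately show "M \<in> (\<lambda>f. \<Union>(range f)) ` Func (UNIV :: nat set) J" by blast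
  qed
  then have "|countable_unions J| \<le>o |Func (UNIV :: nat set) J|"
    by (rule ordLeq_transitive[OF card_of_mono1 card_of_image])
  then show ?thesis by (simp add: cexp_def Field_natLeq Field_card_of)
qed

section \<open>Winning coding strategies\<close>

text \<open>The number of these sets measures how much information TWO can code into a move that
  covers \<open>A\<close>.\<close>

definition extensions :: "'a set set \<Rightarrow> 'a set \<Rightarrow> 'a set set" where
  "extensions J A = {N \<in> J. A \<subseteq> N}"

text \<open>If \<open>A\<close> itself has too few supersets in \<open>J\<close>, then
  \<open>|J|\<close> is at most \<open>|Pow A|\<close>. Halving \<open>A\<close> into two parts of
  size \<open>|A|\<close> then helps: adding to one half the subsets of the other yields
  \<open>|Pow A|\<close> supersets, all inside \<open>A\<close> and hence in
  \<open>J\<close>.\<close>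

lemma split_into_extendible:
  assumes sub: "\<And>A B. A \<in> J \<Longrightarrow> B \<subseteq> A \<Longrightarrow> B \<in> J"
    and un: "\<And>A B. A \<in> J \<Longrightarrow> B \<in> J \<Longrightarrow> A \<union> B \<in> J"
    and inf: "infinite J" and A: "A \<in> J"
  obtains B C where "A = B \<union> C" "|J| \<le>o |extensions J B|" "|J| \<le>o |extensions J C|"
proof (cases "|J| \<le>o |extensions J A|")
  case True
  then show ?thesis using that[of A A] by simp
next
  case False
  then have less: "|extensions J A| <o |J|"
    by (simp add: not_ordLeq_iff_ordLess card_of_Well_order)
  \<comment> \<open>A set \<open>N\<close> is recovered from its trace on \<open>A\<close> and its
    union with \<open>A\<close>, and the latter belongs to \<open>extensions J A\<close>.\<close>
  have prod: "|J| \<le>o |Pow A \<times> extensions J A|"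
  proof (rule card_of_ordLeqI)
    show "inj_on (\<lambda>N. (N \<inter> A, N \<union> A)) J" by (rule inj_onI) blast
    show "(N \<inter> A, N \<union> A) \<in> Pow A \<times> extensions J A" if "N \<in> J" for N
      using un[OF that A] by (simp add: extensions_def)
  qed
  have inf_prod: "infinite (Pow A \<times> extensions J A)" by (rule card_of_ordLeq_infinite[OF prod inf])
  \<comment> \<open>An infinite product has the size of its larger factor; by \<open>less\<close>
    this is \<open>Pow A\<close>.\<close>
  have PA: "|J| \<le>o |Pow A|"
  proof (cases "|Pow A| \<le>o |extensions J A|")
    case True
    have "infinite (extensions J A)"
      using inf_prod card_of_ordLeq_finite[OF True] by auto
    then have "|Pow A \<times> extensions J A| =o |extensions J A|"
      using card_of_Times_infinite[OF _ Pow_not_empty True] by blast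
    then have "|J| \<le>o |extensions J A|" by (rule ordLeq_ordIso_trans[OF prod])
    then show ?thesis using less not_ordLess_ordLeq by blast
  next
    case False
    then have le: "|extensions J A| \<le>o |Pow A|"
      using ordLeq_total card_of_Well_order by blast
    have "infinite (Pow A)"
      using inf_prod card_of_ordLeq_finite[OF le] by auto
    moreover have "extensions J A \<noteq> {}" using A by (auto simp: extensions_def)
    ultimately have "|Pow A \<times> extensions J A| =o |Pow A|"
      using card_of_Times_infinite[OF _ _ le] by blast
    then show ?thesis by (rule ordLeq_ordIso_trans[OF prod])
  qed
  have "infinite A" using card_of_ordLeq_infinite[OF PA inf] by simp
  then obtain B C where BC: "A = B \<union> C" "B \<inter> C = {}" "|A| \<le>o |B|" "|A| \<le>o |C|"
    by (rule infinite_split_halves)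
  have ext: "|J| \<le>o |extensions J D|" if DE: "A = D \<union> E" "D \<inter> E = {}" "|A| \<le>o |E|" for D E
  proof -
    have "|Pow A| \<le>o |Pow E|"
    proof -
      obtain f where "inj_on f A" "f ` A \<subseteq> E" using DE(3) card_of_ordLeq by metis
      then show ?thesis
        by (intro card_of_ordLeqI[of "image f"] inj_on_image_Pow) auto
    qed
    also have "|Pow E| \<le>o |extensions J D|"
    proof (rule card_of_ordLeqI)
      show "inj_on (\<lambda>S. D \<union> S) (Pow E)" using DE(2) by (intro inj_onI) blast
      show "D \<union> S \<in> extensions J D" if "S \<in> Pow E" for S
        using that DE(1) by (auto simp: extensions_def intro: sub[OF A])
    qed
    finally show ?thesis by (rule ordLeq_transitive[OF PA])
  qed
  show ?thesis
    using that[OF BC(1) ext[OF BC(1,2,4)] ext[of C B]] BC by (simp add: Un_commute Int_commute)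
qed

text \<open>TWO answers the history \<open>h\<close> by a superset \<open>c h\<close> of a target,
  and injectivity of \<open>c\<close> allows \<open>h\<close> to be read off from this move alone.
  The targets run through all pieces of all moves of ONE.\<close>

lemma winning_coding_strategy_if_card_le:
  assumes sub: "\<And>A B. A \<in> J \<Longrightarrow> B \<subseteq> A \<Longrightarrow> B \<in> J"
    and un: "\<And>A B. A \<in> J \<Longrightarrow> B \<in> J \<Longrightarrow> A \<union> B \<in> J"
    and inf: "infinite J"
    and le: "|countable_unions J| \<le>o |J|"
  shows "\<exists>F. winning_coding_strategy J F"
proof -
  let ?M = "countable_unions J"
  obtain N0 where "N0 \<in> J" using inf by (metis finite.emptyI ex_in_conv)
  then have emp: "{} \<in> J" using sub by blast
  have pieces: "\<exists>p :: nat \<Rightarrow> 'a set. (\<forall>n. |J| \<le>o |extensions J (p n)| ) \<and> M = (\<Union>n. p n)"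
    if M: "M \<in> ?M" for M
  proof -
    obtain \<C> where C: "countable \<C>" "\<C> \<subseteq> J" "M = \<Union>\<C>"
      using M unfolding countable_unions_def by auto
    have "\<exists>B C. A = B \<union> C \<and> |J| \<le>o |extensions J B| \<and> |J| \<le>o |extensions J C|"
      if "A \<in> \<C>" for A
      by (rule split_into_extendible[OF sub un inf, where A = A]) (use that C(2) in blast)+
    then obtain f g where fg: "\<And>A. A \<in> \<C> \<Longrightarrow>
        A = f A \<union> g A \<and> |J| \<le>o |extensions J (f A)| \<and> |J| \<le>o |extensions J (g A)|"
      by metis
    define \<D> where "\<D> = insert {} (f ` \<C> \<union> g ` \<C>)"
    have "extensions J {} = J" unfolding extensions_def by simp
    then have D: "|J| \<le>o |extensions J A|" if "A \<in> \<D>" for A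
      using that fg unfolding \<D>_def by (auto simp: ordLeq_refl card_of_Card_order)
    have "range (from_nat_into \<D>) = \<D>"
      using C(1) unfolding \<D>_def by (intro range_from_nat_into) auto
    moreover have "M = \<Union>\<D>" unfolding C(3) \<D>_def using fg by blast
    ultimately show ?thesis using D by (metis rangeI)
  qed
  then obtain p :: "'a set \<Rightarrow> nat \<Rightarrow> 'a set" where
    p: "\<And>M n. M \<in> ?M \<Longrightarrow> |J| \<le>o |extensions J (p M n)|" "\<And>M. M \<in> ?M \<Longrightarrow> M = (\<Union>n. p M n)"
    by metis
  \<comment> \<open>In inning \<open>k\<close>, counted from 0, the history has length
    \<open>k + 1\<close>, and \<open>prod_decode k = (i, j)\<close> selects piece \<open>j\<close>
    of move \<open>i\<close>. Always \<open>i \<le> k\<close>, so the value \<open>{}\<close> serves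
    only the empty list.\<close>
  define target where "target h = (case prod_decode (length h - 1) of (i, j) \<Rightarrow>
    if i < length h then p (h ! i) j else {})" for h
  have "infinite ?M"
  proof -
    have "J \<subseteq> ?M" unfolding countable_unions_def by (auto intro!: exI[of _ "{_}"])
    then show ?thesis using inf infinite_super by blast
  qed
  then have "|lists ?M| \<le>o |J|"
    by (rule ordLeq_transitive[OF card_of_lists_infinite le])
  moreover have "|J| \<le>o |extensions J (target h)|" if "h \<in> lists ?M" for h
  proof -
    have "extensions J {} = J" unfolding extensions_def by simp
    then show ?thesis using that p(1) unfolding target_def
      by (auto split: prod.split simp: card_of_mono1 in_lists_conv_set)
  qed
  ultimately have "|lists ?M| \<le>o |extensions J (target h)|" if "h \<in> lists ?M" for h
    using that ordLeq_transitive by blast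
  then obtain c where c: "inj_on c (lists ?M)"
      "\<And>h. h \<in> lists ?M \<Longrightarrow> c h \<in> extensions J (target h)"
    by (rule injective_choice) blast+
  have cJ: "c h \<in> J" "target h \<subseteq> c h" if "h \<in> lists ?M" for h
    using c(2)[OF that] by (auto simp: extensions_def)
  \<comment> \<open>The history is decoded from \<open>N\<close> by inverting \<open>c\<close>, and
    \<open>M\<close> is appended. The value \<open>{}\<close> for other \<open>N\<close> keeps
    \<open>F\<close> inside \<open>J\<close>; such \<open>N\<close> do not occur in a play.\<close>
  define F where "F = (\<lambda>x. case x of Inl M \<Rightarrow> c [M] | Inr (N, M) \<Rightarrow>
    if N \<in> c ` lists ?M then c (inv_into (lists ?M) c N @ [M]) else {})"
  have F_Inr: "F (Inr (c h, M)) = c (h @ [M])" if "h \<in> lists ?M" for h M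
    using that c(1) by (simp add: F_def)
  have "coding_strategy J F"
    unfolding coding_strategy_def
  proof
    fix x assume x: "x \<in> ?M <+> (J \<times> ?M)"
    show "F x \<in> J"
    proof (cases x)
      case (Inl M)
      then show ?thesis using x by (auto simp: F_def intro!: cJ(1))
    next
      case (Inr y)
      then obtain N M where x': "x = Inr (N, M)" "M \<in> ?M" using x by auto
      show ?thesis
      proof (cases "N \<in> c ` lists ?M")
        case True
        then obtain h where "h \<in> lists ?M" "N = c h" by blast
        then show ?thesis using x' F_Inr cJ(1)[of "h @ [M]"] by simp
      qed (simp add: x' F_def emp)
    qed
  qed
  moreover have "(\<Union>k. M k) \<subseteq> (\<Union>k. coding_move F M k)" if M: "\<And>k. M k \<in> ?M" for M
  proof -
    have h: "map M [0..<k] \<in> lists ?M" for k using M by auto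
    have move: "coding_move F M k = c (map M [0..<Suc k])" for k
    proof (induction k)
      case 0
      show ?case by (simp add: F_def)
    next
      case (Suc k)
      then show ?case using F_Inr[OF h[of "Suc k"]] by simp
    qed
    show ?thesis
    proof
      fix x assume "x \<in> (\<Union>k. M k)"
      then obtain i j where ij: "x \<in> p (M i) j" using p(2)[OF M] by blast
      define k where "k = prod_encode (i, j)"
      have "i \<le> k" unfolding k_def by (rule le_prod_encode_1)
      then have "target (map M [0..<Suc k]) = p (M i) j"
        unfolding target_def by (simp add: k_def nth_append del: upt_Suc)
      then have "x \<in> coding_move F M k" using cJ(2)[OF h[of "Suc k"]] ij move by auto
      then show "x \<in> (\<Union>k. coding_move F M k)" by blast
    qed
  qed
  ultimately show ?thesis unfolding winning_coding_strategy_def by blast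
qed

text \<open>A point that TWO is committed to cover after the move \<open>N\<close> gets covered even if ONE only
  plays the empty set from then on; the union \<open>D N\<close> of the moves of TWO in that play therefore
  contains all meager sets that TWO answers by \<open>N\<close>.\<close>

lemma winning_coding_strategy_dominating:
  assumes "winning_coding_strategy J F" and emp: "{} \<in> J"
  obtains D where "\<And>N. N \<in> J \<Longrightarrow> D N \<in> countable_unions J"
    "\<And>M. M \<in> countable_unions J \<Longrightarrow> F (Inl M) \<in> J \<and> M \<subseteq> D (F (Inl M))"
proof -
  let ?M = "countable_unions J"
  have F: "F \<in> ?M <+> (J \<times> ?M) \<rightarrow> J"
    and win: "\<And>M. (\<And>k. M k \<in> ?M) \<Longrightarrow> (\<Union>k. M k) \<subseteq> (\<Union>k. coding_move F M k)"
    using assms(1) unfolding winning_coding_strategy_def coding_strategy_def by blast+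
  have emp': "{} \<in> ?M" unfolding countable_unions_def by (auto intro!: exI[of _ "{}"])
  \<comment> \<open>\<open>F\<close> sees only the last move of TWO, so the replies to empty moves
    after \<open>N\<close> form an orbit that depends on \<open>N\<close> alone.\<close>
  define G where "G N k = ((\<lambda>N. F (Inr (N, {}))) ^^ k) N" for N k
  show ?thesis
  proof (rule that[of "\<lambda>N. \<Union>(range (G N))"])
    fix N assume N: "N \<in> J"
    have "G N k \<in> J" for k
      unfolding G_def using N F emp' by (induction k) (auto simp: Pi_iff)
    then show "\<Union>(range (G N)) \<in> ?M"
      unfolding countable_unions_def by (auto intro!: exI[of _ "range (G N)"])
  next
    fix M assume M: "M \<in> ?M"
    let ?play = "\<lambda>k :: nat. if k = 0 then M else {}"
    have "coding_move F ?play k = G (F (Inl M)) k" for k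
      unfolding G_def by (induction k) auto
    moreover have "(\<Union>k. ?play k) \<subseteq> (\<Union>k. coding_move F ?play k)"
      using win[of ?play] M emp' by simp
    moreover have "M \<subseteq> (\<Union>k. ?play k)" by (auto intro!: exI[of _ 0])
    ultimately have "M \<subseteq> \<Union>(range (G (F (Inl M))))" by simp
    then show "F (Inl M) \<in> J \<and> M \<subseteq> \<Union>(range (G (F (Inl M))))" using F M by auto
  qed
qed

section \<open>Countable cofinality and \<omega>-th powers of cardinals\<close>

lemma card_of_countable:
  assumes "countable A"
  shows "|A| \<le>o |UNIV :: nat set|"
proof -
  obtain f :: "'a \<Rightarrow> nat" where "inj_on f A" using assms unfolding countable_def by blast
  then show ?thesis by (rule card_of_ordLeqI) simp
qed

lemma not_countable_cofinal:
  assumes "Cinfinite \<kappa>" "natLeq <o cofinality \<kappa>" "K \<subseteq> Field \<kappa>" "cofinal K \<kappa>"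
  shows "uncountable K"
proof
  assume "countable K"
  then have "|K| \<le>o natLeq" by (rule ordLeq_ordIso_trans[OF card_of_countable card_of_nat])
  then have "cofinality \<kappa> \<le>o natLeq"
    using ordLeq_transitive cofinality_least[OF assms(1,3,4)] by blast
  then show False using assms(2) not_ordLess_ordLeq by blast
qed

text \<open>\<open>cofinal\<close> asks for elements strictly above each point, so its failure gives
  only a weak upper bound \<open>a\<close>. An infinite cardinal has no last element, and any
  \<open>b\<close> beyond \<open>a\<close> is a strict bound.\<close>

lemma not_cofinal_bounded:
  assumes r: "Cinfinite r" and K: "K \<subseteq> Field r" "\<not> cofinal K r"
  obtains b where "b \<in> Field r" "K \<subseteq> underS r b"
proof -
  have co: "Card_order r" and inf: "infinite (Field r)" using r by (auto simp: cinfinite_def)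
  obtain a where a: "a \<in> Field r" "\<And>k. k \<in> K \<Longrightarrow> a = k \<or> (a, k) \<notin> r"
    using K(2) unfolding cofinal_def by auto
  obtain b where b: "b \<in> Field r" "a \<noteq> b" "(a, b) \<in> r"
    using infinite_Card_order_limit[OF co inf a(1)] by blast
  have "well_order_on (Field r) r" using co by (simp add: card_order_on_def)
  then have ord: "refl_on (Field r) r" "trans r" "antisym r" "total_on (Field r) r"
    by (auto simp: well_order_on_def linear_order_on_def partial_order_on_def preorder_on_def)
  have "k \<in> underS r b" if k: "k \<in> K" for k
  proof -
    have "k \<in> Field r" using k K(1) by auto
    then have "(k, a) \<in> r"
      using a(1) a(2)[OF k] ord(1,4) unfolding total_on_def refl_on_def by metis
    then have "(k, b) \<in> r" "k \<noteq> b"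
      using b ord(2,3) unfolding trans_def antisym_def by blast+
    then show ?thesis unfolding underS_def by simp
  qed
  then show ?thesis using that b(1) by blast
qed

text \<open>If no countable set is cofinal in \<open>r\<close>, then every sequence in \<open>r\<close> is bounded, so that
  \<open>r\<^sup>\<omega>\<close> is the supremum of the \<open>\<omega>\<close>-th powers of the initial segments.\<close>

lemma cexp_natLeq_ordLeq:
  assumes r: "Cinfinite r"
    and unc: "\<And>K. K \<subseteq> Field r \<Longrightarrow> countable K \<Longrightarrow> \<not> cofinal K r"
    and small: "\<And>B. B \<subseteq> Field r \<Longrightarrow> |B| <o r \<Longrightarrow> |B| ^c natLeq \<le>o r"
  shows "r ^c natLeq \<le>o r"
proof -
  have co: "Card_order r" using r by auto
  have "Func (UNIV :: nat set) (Field r) \<subseteq> (\<Union>b\<in>Field r. Func UNIV (underS r b))"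
  proof
    fix f :: "nat \<Rightarrow> 'a" assume "f \<in> Func UNIV (Field r)"
    then have "range f \<subseteq> Field r" unfolding Func_def by auto
    then obtain b where "b \<in> Field r" "range f \<subseteq> underS r b"
      using not_cofinal_bounded[OF r] unc by (metis countableI_type countable_image)
    then show "f \<in> (\<Union>b\<in>Field r. Func UNIV (underS r b))" unfolding Func_def by auto
  qed
  moreover have "|\<Union>b\<in>Field r. Func (UNIV :: nat set) (underS r b)| \<le>o r"
  proof (rule UNION_Cinfinite_bound[OF _ ballI r])
    show "|Field r| \<le>o r" using card_of_Field_ordIso[OF co] ordIso_imp_ordLeq by blast
    fix b assume "b \<in> Field r"
    then have "|underS r b| ^c natLeq \<le>o r"
      by (intro small card_of_underS[OF co]) (auto intro: underS_Field)
    then show "|Func (UNIV :: nat set) (underS r b)| \<le>o r"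
      by (simp add: cexp_def Field_natLeq Field_card_of)
  qed
  ultimately show ?thesis
    unfolding cexp_def Field_natLeq using ordLeq_transitive[OF card_of_mono1] by blast
qed

text \<open>With a set \<open>D\<close> absorbing both \<open>B\<close> and \<omega>,
  \<open>|B|^\<omega> \<le> (2^|D|)^\<omega> = 2^|D| < \<kappa>\<close>.\<close>

lemma strong_limit_cexp_natLeq:
  fixes \<kappa> :: "'a rel"
  assumes lim: "strong_limit_cardinal \<kappa>" and unc: "natLeq <o \<kappa>" and B: "|B| <o \<kappa>"
  shows "|B| ^c natLeq \<le>o \<kappa>"
proof -
  have k: "Cinfinite \<kappa>" using lim by (simp add: strong_limit_cardinal_def)
  have "|UNIV :: nat set| <o \<kappa>" using ordIso_ordLess_trans[OF card_of_nat unc] .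
  then have "|B <+> (UNIV :: nat set)| <o \<kappa>"
    using k B by (intro card_of_Plus_ordLess_infinite_Field) (auto simp: cinfinite_def)
  \<comment> \<open>The copy \<open>D\<close> is taken inside \<open>Field \<kappa>\<close> because
    strong limits are defined through cardinals on \<open>'a\<close>.\<close>
  then obtain D where D: "|B <+> (UNIV :: nat set)| =o |D|" "|D| <o \<kappa>" "D \<subset> Field \<kappa>"
    using iffD1[OF internalize_card_of_ordLess] by blast
  have le: "|B| \<le>o |D|" "|UNIV :: nat set| \<le>o |D|"
    using ordLeq_ordIso_trans[OF card_of_Plus1 D(1)] ordLeq_ordIso_trans[OF card_of_Plus2 D(1)] .
  have nat_le: "natLeq \<le>o |D|"
    using ordIso_ordLeq_trans[OF ordIso_symmetric[OF card_of_nat] le(2)] .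
  have cD: "Cinfinite |D|"
    using cinfinite_mono[OF nat_le natLeq_cinfinite] card_of_Card_order by blast
  have "|B| ^c natLeq \<le>o (ctwo ^c |D| ) ^c natLeq"
    using ordLess_ctwo_cexp[OF card_of_Card_order, of D] le(1)
    by (intro cexp_mono1 natLeq_Card_order) (blast intro: ordLeq_transitive ordLess_imp_ordLeq)
  also have "(ctwo ^c |D| ) ^c natLeq =o ctwo ^c |D|"
    by (rule cexp_cprod_ordLeq[OF Card_order_ctwo cD Cinfinite_Cnotzero[OF natLeq_Cinfinite] nat_le])
  also have "ctwo ^c |D| <o \<kappa>"
    using lim D(2) card_of_Card_order unfolding strong_limit_cardinal_def by blast
  finally show ?thesis by (rule ordLess_imp_ordLeq)
qed

lemma singular_uncountable:
  assumes "singular_cardinal \<kappa>" "natLeq <o cofinality \<kappa>"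
  shows "Cinfinite \<kappa>" "natLeq <o \<kappa>"
  using assms ordLess_transitive singular_cardinal_iff_cofinality by blast+

lemma singular_strong_limit_cexp_natLeq:
  assumes "singular_cardinal \<kappa>" "strong_limit_cardinal \<kappa>" "natLeq <o cofinality \<kappa>"
  shows "\<kappa> ^c natLeq \<le>o \<kappa>"
proof -
  note u = singular_uncountable[OF assms(1,3)]
  show ?thesis
    using cexp_natLeq_ordLeq[OF u(1)] not_countable_cofinal[OF u(1) assms(3)]
      strong_limit_cexp_natLeq[OF assms(2) u(2)] by blast
qed

lemma finite_UN_ordLess:
  assumes r: "Cinfinite r" and "finite T" "\<And>t. t \<in> T \<Longrightarrow> |A t| <o r"
  shows "|\<Union>t\<in>T. A t| <o r"
  using assms(2,3)
proof (induction T rule: finite_induct)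
  case empty
  show ?case
    using r by (intro Cfinite_ordLess_Cinfinite)
      (auto simp: cfinite_def Field_card_of card_of_card_order_on)
next
  case (insert t T)
  have "|A t \<union> (\<Union>t\<in>T. A t)| <o r"
    by (rule Un_Cinfinite_bound_strict[OF _ _ r]) (use insert in auto)
  then show ?case by simp
qed

lemma finite_quotient_representatives:
  assumes "finite (A // R)" "\<And>a. a \<in> A \<Longrightarrow> (a, a) \<in> R"
  obtains T where "finite T" "T \<subseteq> A" "\<And>a. a \<in> A \<Longrightarrow> \<exists>t\<in>T. (a, t) \<in> R"
proof -
  have "\<exists>t. t \<in> q \<inter> A" if "q \<in> A // R" for q
    using that assms(2) by (auto elim!: quotientE)
  then obtain f where f: "\<And>q. q \<in> A // R \<Longrightarrow> f q \<in> q \<inter> A" by metis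
  show ?thesis
  proof (rule that[of "f ` (A // R)"])
    show "finite (f ` (A // R))" using assms(1) by simp
    show "f ` (A // R) \<subseteq> A" using f by blast
    fix a assume "a \<in> A"
    then have "R `` {a} \<in> A // R" by (rule quotientI)
    then show "\<exists>t\<in>f ` (A // R). (a, t) \<in> R" using f by blast
  qed
qed

text \<open>Well-founded induction on \<open><o\<close>, with the two endpoints treated separately.
  Strictly between them the induction hypothesis handles all smaller sets, so by
  \<open>cexp_natLeq_ordLeq\<close> it remains to exclude a countable cofinal set in
  \<open>r\<close>.\<close>

lemma finitely_many_cexp_natLeq:
  fixes \<kappa> :: "'a rel" and r :: "('a \<Rightarrow> bool) rel"
  assumes sing: "singular_cardinal \<kappa>" and lim: "strong_limit_cardinal \<kappa>"
    and cf: "natLeq <o cofinality \<kappa>"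
    and fin: "finitely_many_cardinals_between_power \<kappa>"
    and r: "Card_order r" "\<kappa> \<le>o r" "r \<le>o ctwo ^c \<kappa>"
  shows "r ^c natLeq \<le>o r"
  using r
proof (induction r rule: wf_induct_rule[OF wf_ordLess])
  case (1 r)
  note IH = 1(1) and r = 1(2-4)
  note k = singular_uncountable[OF sing cf]
  have wk: "Well_order \<kappa>" using k(1) by (simp add: card_order_on_def)
  have kexp: "\<kappa> ^c natLeq \<le>o \<kappa>" by (rule singular_strong_limit_cexp_natLeq[OF sing lim cf])
  have cr: "Cinfinite r" using cinfinite_mono[OF r(2)] k r(1) by blast
  consider "r =o ctwo ^c \<kappa>" | "\<kappa> =o r" | "\<kappa> <o r" "r <o ctwo ^c \<kappa>"
    using r(2,3) iffD1[OF ordLeq_iff_ordLess_or_ordIso] by metis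
  then show ?case
  proof cases
    case 1
    \<comment> \<open>\<open>(2^\<kappa>)^\<omega> = 2^(\<kappa> * \<omega>) = 2^\<kappa>\<close>.\<close>
    have "r ^c natLeq =o (ctwo ^c \<kappa>) ^c natLeq" by (rule cexp_cong1[OF 1 natLeq_Card_order])
    also have "(ctwo ^c \<kappa>) ^c natLeq =o ctwo ^c \<kappa>"
      using k by (intro cexp_cprod_ordLeq Card_order_ctwo Cinfinite_Cnotzero natLeq_Cinfinite)
        (auto intro: ordLess_imp_ordLeq)
    also have "ctwo ^c \<kappa> =o r" using 1 by (rule ordIso_symmetric)
    finally show ?thesis by (rule ordIso_imp_ordLeq)
  next
    case 2
    have "r ^c natLeq =o \<kappa> ^c natLeq"
      by (rule cexp_cong1[OF ordIso_symmetric[OF 2] natLeq_Card_order])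
    also note kexp
    also note 2
    finally show ?thesis .
  next
    case 3
    show ?thesis
    proof (rule cexp_natLeq_ordLeq[OF cr])
      fix B assume B: "B \<subseteq> Field r" "|B| <o r"
      show "|B| ^c natLeq \<le>o r"
      proof (cases "|B| \<le>o \<kappa>")
        case True
        have "|B| ^c natLeq \<le>o \<kappa> ^c natLeq" by (rule cexp_mono1[OF True natLeq_Card_order])
        also note kexp
        also note r(2)
        finally show ?thesis .
      next
        case False
        then have "\<kappa> \<le>o |B|" using ordLeq_total[OF card_of_Well_order wk] by blast
        then have "|B| ^c natLeq \<le>o |B|"
          using IH[OF B(2) card_of_Card_order] ordLess_imp_ordLeq[OF ordLess_ordLeq_trans[OF B(2) r(3)]]
          by blast
        then show ?thesis using ordLess_imp_ordLeq[OF B(2)] by (rule ordLeq_transitive)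
      qed
    next
      fix K assume K: "K \<subseteq> Field r" "countable K"
      show "\<not> cofinal K r"
      proof
        assume cof: "cofinal K r"
        let ?C = "cardinals_between_power \<kappa>"
        obtain T where T: "finite T" "T \<subseteq> ?C" "\<And>c. c \<in> ?C \<Longrightarrow> \<exists>t\<in>T. c =o t"
          using finite_quotient_representatives[of ?C ordIso] fin
          unfolding finitely_many_cardinals_between_power_def cardinals_between_power_def
          by (auto intro: ordIso_refl)
        \<comment> \<open>Only finitely many sizes occur strictly between \<kappa> and
          \<open>r\<close>. The union \<open>B\<close> of their representatives is smaller than
          \<open>r\<close>, yet together with \<open>Field \<kappa>\<close> it is at least as large
          as every proper initial segment.\<close>
        define B where "B = (\<Union>t\<in>{t\<in>T. t <o r}. Field t)"
        have "|B| <o r" unfolding B_def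
          by (rule finite_UN_ordLess[OF cr]) (use T(1) in \<open>auto intro: ordLess_Field\<close>)
        moreover have "|Field \<kappa>| <o r" using ordLess_Field 3(1) by blast
        ultimately have less: "|Field \<kappa> <+> B| <o r"
          using cr by (intro card_of_Plus_ordLess_infinite_Field) (auto simp: cinfinite_def)
        have kle: "\<kappa> \<le>o |Field \<kappa> <+> B|"
          using ordIso_ordLeq_trans[OF ordIso_symmetric[OF card_of_Field_ordIso] card_of_Plus1] k
          by blast
        have inf: "Cinfinite |Field \<kappa> <+> B|"
          using cinfinite_mono[OF kle] k card_of_Card_order by blast
        have seg: "|underS r a| \<le>o |Field \<kappa> <+> B|" if "a \<in> Field r" for a
        proof (cases "|underS r a| \<le>o \<kappa>")
          case True
          then show ?thesis using kle by (rule ordLeq_transitive)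
        next
          case False
          have lt: "|underS r a| <o r" using card_of_underS[OF r(1) that] .
          have "\<kappa> <o |underS r a|"
            using False by (simp only: not_ordLeq_iff_ordLess[OF wk card_of_Well_order])
          then have "|underS r a| \<in> ?C"
            unfolding cardinals_between_power_def
            using card_of_Card_order ordLess_transitive[OF lt 3(2)] by (intro CollectI conjI)
          then obtain t where t: "t \<in> T" "|underS r a| =o t" using T(3) by blast
          have "t <o r" using ordIso_ordLess_trans[OF ordIso_symmetric[OF t(2)] lt] .
          then have "Field t \<subseteq> B" using t(1) unfolding B_def by blast
          have "Card_order t" using t(1) T(2) unfolding cardinals_between_power_def by blast
          have "|underS r a| =o |Field t|"
            by (rule ordIso_transitive[OF t(2) ordIso_symmetric[OF card_of_Field_ordIso]]) fact
          also have "|Field t| \<le>o |B|" using \<open>Field t \<subseteq> B\<close> by (rule card_of_mono1)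
          also have "|B| \<le>o |Field \<kappa> <+> B|" by (rule card_of_Plus2)
          finally show ?thesis .
        qed
        \<comment> \<open>A cofinal \<open>K\<close> would make \<open>r\<close> a union of
          countably many segments of size at most \<open>|Field \<kappa> <+> B|\<close>, which is
          below \<open>r\<close>.\<close>
        have "Field r \<subseteq> (\<Union>a\<in>K. underS r a)"
          using cof unfolding cofinal_def underS_def by blast
        then have "|Field r| \<le>o |\<Union>a\<in>K. underS r a|" by (rule card_of_mono1)
        also have "|\<Union>a\<in>K. underS r a| \<le>o |Field \<kappa> <+> B|"
        proof (rule UNION_Cinfinite_bound[OF _ _ inf])
          have "|K| \<le>o |UNIV :: nat set|"
            using K(2) by (rule card_of_countable)
          also have "|UNIV :: nat set| \<le>o |Field \<kappa> <+> B|"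
            by (rule ordIso_ordLeq_trans[OF card_of_nat natLeq_ordLeq_cinfinite[OF inf]])
          finally show "|K| \<le>o |Field \<kappa> <+> B|" .
          show "\<forall>a\<in>K. |underS r a| \<le>o |Field \<kappa> <+> B|" using seg K(1) by blast
        qed
        also note less
        finally have "|Field r| <o r" .
        then show False using card_of_Field_ordIso[OF r(1)] by (rule notE[OF not_ordLess_ordIso])
      qed
    qed
  qed
qed

section \<open>Nowhere dense sets\<close>

lemma nowhere_dense_sets_subset:
  assumes "A \<in> nowhere_dense_sets X" "B \<subseteq> A"
  shows "B \<in> nowhere_dense_sets X"
proof -
  have "X interior_of (X closure_of B) \<subseteq> X interior_of (X closure_of A)"
    by (intro interior_of_mono closure_of_mono assms(2))
  then show ?thesis using assms unfolding nowhere_dense_sets_def by auto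
qed

lemma nowhere_dense_sets_Un:
  assumes "A \<in> nowhere_dense_sets X" "B \<in> nowhere_dense_sets X"
  shows "A \<union> B \<in> nowhere_dense_sets X"
  using assms unfolding nowhere_dense_sets_def
  by (simp add: interior_of_union_eq_empty)

lemma nowhere_dense_sets_singleton:
  assumes "t1_space X" "no_isolated_points X" "x \<in> topspace X"
  shows "{x} \<in> nowhere_dense_sets X"
proof -
  have "X closure_of {x} = {x}" using assms by (simp add: closure_of_eq closedin_t1_singleton)
  moreover have "X interior_of {x} \<noteq> {x}"
    using assms by (simp add: interior_of_eq no_isolated_points_def)
  then have "X interior_of {x} = {}" using interior_of_subset[of X "{x}"] by blast
  ultimately show ?thesis using assms by (simp add: nowhere_dense_sets_def)
qed

text \<open>Singletons and the power set place \<open>|J|\<close> between \<kappa> and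
  \<open>2^\<kappa>\<close>, where \<omega>-th powers do not increase cardinals; hence there are no
  more meager sets than nowhere dense ones.\<close>

lemma winning_coding_strategy_if_finitely_many:
  fixes \<kappa> :: "'a rel" and \<tau> :: "'a topology"
  assumes sing: "singular_cardinal \<kappa>" and lim: "strong_limit_cardinal \<kappa>"
    and cf: "natLeq <o cofinality \<kappa>"
    and fin: "finitely_many_cardinals_between_power \<kappa>"
    and \<tau>: "topspace \<tau> = Field \<kappa>" "t1_space \<tau>" "no_isolated_points \<tau>"
  shows "\<exists>F. winning_coding_strategy (nowhere_dense_sets \<tau>) F"
proof -
  let ?J = "nowhere_dense_sets \<tau>"
  note k = singular_uncountable[OF sing cf]
  have "\<kappa> =o |Field \<kappa>|" using card_of_Field_ordIso ordIso_symmetric k by blast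
  also have "|Field \<kappa>| \<le>o |?J|"
    using nowhere_dense_sets_singleton[OF \<tau>(2,3)] \<tau>(1)
    by (intro card_of_ordLeqI[of "\<lambda>x. {x}"]) auto
  finally have ge: "\<kappa> \<le>o |?J|" .
  have "?J \<subseteq> Pow (Field \<kappa>)" using \<tau>(1) unfolding nowhere_dense_sets_def by blast
  then have "|?J| \<le>o |Pow (Field \<kappa>)|" by (rule card_of_mono1)
  also have "|Pow (Field \<kappa>)| =o ctwo ^c \<kappa>"
    unfolding cexp_def ctwo_def Field_card_of by (rule card_of_Pow_Func)
  finally have le: "|?J| \<le>o ctwo ^c \<kappa>" .
  \<comment> \<open>A copy of \<open>?J\<close> on the type \<open>'a \<Rightarrow> bool\<close>, on
    which \<open>finitely_many_cexp_natLeq\<close> is stated.\<close>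
  then obtain B :: "('a \<Rightarrow> bool) set" where B: "|?J| =o |B|" "|B| \<le>o ctwo ^c \<kappa>"
    using iffD1[OF internalize_card_of_ordLeq] by blast
  have inf: "infinite ?J" using cinfinite_mono[OF ge] k by (simp add: cinfinite_def Field_card_of)
  then obtain N where "N \<in> ?J" by (metis finite.emptyI ex_in_conv)
  then have "{} \<in> ?J" using nowhere_dense_sets_subset by blast
  then have "|countable_unions ?J| \<le>o |?J| ^c natLeq" by (rule card_of_countable_unions)
  also have "|?J| ^c natLeq =o |B| ^c natLeq" by (rule cexp_cong1[OF B(1) natLeq_Card_order])
  also have "|B| ^c natLeq \<le>o |B|"
    using finitely_many_cexp_natLeq[OF sing lim cf fin card_of_Card_order _ B(2)]
      ordLeq_ordIso_trans[OF ge B(1)] by blast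
  also have "|B| =o |?J|" using B(1) by (rule ordIso_symmetric)
  finally show ?thesis
    by (rule winning_coding_strategy_if_card_le[OF _ _ inf, rotated 2])
      (fact nowhere_dense_sets_subset, fact nowhere_dense_sets_Un)
qed

section \<open>Spaces without a winning coding strategy\<close>

text \<open>Repeatedly pick a least member and keep only what lies strictly above it. This discards
  a single class modulo \<open>ordIso\<close>, so infinitely many remain.\<close>

lemma increasing_cardinals:
  assumes inf: "infinite (C // ordIso)" and wo: "\<And>c. c \<in> C \<Longrightarrow> Well_order c"
  obtains l :: "nat \<Rightarrow> 'a rel" where "\<And>n. l n \<in> C" "\<And>n. l n <o l (Suc n)"
proof -
  define P where "P S \<longleftrightarrow> S \<subseteq> C \<and> infinite (S // ordIso)" for S
  have step: "\<exists>m\<in>S. P {s \<in> S. m <o s}" if "P S" for S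
  proof -
    have "S \<noteq> {}" using that unfolding P_def by (auto simp: quotient_def)
    moreover have wS: "\<forall>s\<in>S. Well_order s" using that wo unfolding P_def by blast
    ultimately obtain m where m: "m \<in> S" "\<forall>s\<in>S. m \<le>o s"
      using exists_minim_Well_order[of S] by blast
    have "S // ordIso \<subseteq> insert (ordIso `` {m}) ({s \<in> S. m <o s} // ordIso)"
    proof
      fix q assume "q \<in> S // ordIso"
      then obtain s where s: "s \<in> S" "q = ordIso `` {s}" by (rule quotientE)
      show "q \<in> insert (ordIso `` {m}) ({s \<in> S. m <o s} // ordIso)"
      proof (cases "m <o s")
        case True
        then show ?thesis using s by (auto intro: quotientI)
      next
        case False
        then have ms: "m =o s" using m(2) s(1) ordLeq_iff_ordLess_or_ordIso by blast
        then have "q = ordIso `` {m}"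
          using s(2) ordIso_transitive[OF ms] ordIso_transitive[OF ordIso_symmetric[OF ms]] by auto
        then show ?thesis by simp
      qed
    qed
    then have "infinite ({s \<in> S. m <o s} // ordIso)"
      using that finite_subset unfolding P_def by blast
    then show ?thesis using m(1) that unfolding P_def by blast
  qed
  have "\<exists>S. \<forall>n. P (S n) \<and> (\<exists>m\<in>S n. S (Suc n) = {s \<in> S n. m <o s})"
  proof (rule dependent_nat_choice)
    show "\<exists>S. P S" using inf unfolding P_def by blast
    show "\<exists>S'. P S' \<and> (\<exists>m\<in>S. S' = {s \<in> S. m <o s})" if "P S" for S using step[OF that] by blast
  qed
  then obtain S where S: "\<And>n. P (S n)" "\<And>n. \<exists>m\<in>S n. S (Suc n) = {s \<in> S n. m <o s}" by blast
  have "\<exists>l. \<forall>n. l n \<in> S n \<and> S (Suc n) = {s \<in> S n. l n <o s}"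
    using S(2) by (intro choice allI) blast
  then obtain l where l: "\<And>n. l n \<in> S n" "\<And>n. S (Suc n) = {s \<in> S n. l n <o s}" by blast
  show ?thesis
  proof (rule that[of l])
    show "l n \<in> C" for n using l(1) S(1) unfolding P_def by blast
    show "l n <o l (Suc n)" for n using l(1)[of "Suc n"] l(2)[of n] by simp
  qed
qed

text \<open>Diagonalization: a family indexed by \<open>J\<close> cannot dominate all countable unions, because
  \<open>|J|\<close> is bounded by a limit of countable cofinality.\<close>

lemma no_winning_coding_strategy:
  fixes I :: "nat \<Rightarrow> 'i set" and A :: "'i \<Rightarrow> 'a set"
  assumes emp: "{} \<in> J"
    and A: "\<And>n i. i \<in> I n \<Longrightarrow> A i \<in> J"
    and ctbl: "\<And>D. D \<in> countable_unions J \<Longrightarrow> countable {i \<in> \<Union>(range I). A i \<subseteq> D}"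
    and inf: "\<And>n. infinite (I n)" and less: "\<And>n. |I n| <o |I (Suc n)|"
    and le: "|J| \<le>o |\<Union>(range I)|"
  shows "\<not> winning_coding_strategy J F"
proof
  assume "winning_coding_strategy J F"
  then obtain D where D: "\<And>N. N \<in> J \<Longrightarrow> D N \<in> countable_unions J"
    "\<And>M. M \<in> countable_unions J \<Longrightarrow> F (Inl M) \<in> J \<and> M \<subseteq> D (F (Inl M))"
    using winning_coding_strategy_dominating[OF _ emp] by metis
  obtain h where h: "inj_on h J" "h ` J \<subseteq> \<Union>(range I)" using le card_of_ordLeq by metis
  \<comment> \<open>\<open>S n\<close> gathers the indices of sets dominated by some
    \<open>D N\<close> with code \<open>h N\<close> in \<open>I n\<close>. Each \<open>N\<close>
    contributes countably many by \<open>ctbl\<close>, so \<open>S n\<close> cannot exhaust the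
    larger \<open>I (Suc n)\<close>.\<close>
  define S where "S n = (\<Union>N\<in>{N\<in>J. h N \<in> I n}. {i \<in> \<Union>(range I). A i \<subseteq> D N})" for n
  have "|S n| \<le>o |I n|" for n
    unfolding S_def
  proof (rule UNION_Cinfinite_bound[OF _ ballI])
    show c: "Cinfinite |I n|"
      using inf by (simp add: cinfinite_def Field_card_of card_of_card_order_on)
    show "|{N \<in> J. h N \<in> I n}| \<le>o |I n|"
      using h(1) by (intro card_of_ordLeqI[of h]) (auto intro: inj_on_subset)
    fix N assume "N \<in> {N \<in> J. h N \<in> I n}"
    then have "countable {i \<in> \<Union>(range I). A i \<subseteq> D N}" using ctbl D(1) by blast
    then have "|{i \<in> \<Union>(range I). A i \<subseteq> D N}| \<le>o |UNIV :: nat set|"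
      by (rule card_of_countable)
    also have "|UNIV :: nat set| \<le>o |I n|"
      by (rule ordIso_ordLeq_trans[OF card_of_nat natLeq_ordLeq_cinfinite[OF c]])
    finally show "|{i \<in> \<Union>(range I). A i \<subseteq> D N}| \<le>o |I n|" .
  qed
  then have "|S n| <o |I (Suc n)|" for n using less by (rule ordLeq_ordLess_trans)
  then have "\<not> I (Suc n) \<subseteq> S n" for n using card_of_mono1 not_ordLess_ordLeq by metis
  then have "\<exists>i. i \<in> I (Suc n) \<and> i \<notin> S n" for n by blast
  then obtain i where i: "\<And>n. i n \<in> I (Suc n)" "\<And>n. i n \<notin> S n" by metis
  \<comment> \<open>The diagonal union: TWO's answer to it has its code in some \<open>I n\<close>,
    which forces the omitted index \<open>i n\<close> into \<open>S n\<close>.\<close>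
  let ?M = "\<Union>n. A (i n)"
  have "?M \<in> countable_unions J"
    unfolding countable_unions_def using A i(1) by (auto intro!: exI[of _ "range (\<lambda>n. A (i n))"])
  then have N: "F (Inl ?M) \<in> J" "?M \<subseteq> D (F (Inl ?M))" using D(2) by blast+
  then obtain n where "h (F (Inl ?M)) \<in> I n" using h(2) by blast
  moreover have "i n \<in> \<Union>(range I)" using i(1) by blast
  ultimately have "i n \<in> S n" unfolding S_def using N by blast
  then show False using i(2) by blast
qed

section \<open>Almost disjoint sets and the topology of an ideal\<close>

lemma strong_limit_Pow:
  assumes "strong_limit_cardinal \<kappa>" "|B| <o \<kappa>"
  shows "|Pow (B :: 'a set)| <o (\<kappa> :: 'a rel)"
proof -
  have "|Pow B| =o ctwo ^c |B|"
    unfolding cexp_def ctwo_def Field_card_of by (rule card_of_Pow_Func)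
  also have "ctwo ^c |B| <o \<kappa>"
    using assms card_of_Card_order unfolding strong_limit_cardinal_def by blast
  finally show ?thesis .
qed

text \<open>With \<open>K\<close> cofinal in \<open>\<kappa>\<close>, the branch of \<open>X\<close> is the set of the pairs \<open>(\<alpha>, X \<inter> \<alpha>)\<close>, \<open>\<alpha> \<in> K\<close>.
  As \<open>\<kappa>\<close> is a strong limit, there are only \<open>\<kappa>\<close> such pairs and they can be coded by elements
  of \<open>\<kappa>\<close>. Branches of different sets agree only on a bounded part of \<open>K\<close>.\<close>

lemma almost_disjoint_branches:
  fixes \<kappa> :: "'a rel"
  assumes sing: "singular_cardinal \<kappa>" and lim: "strong_limit_cardinal \<kappa>"
    and cf: "natLeq <o cofinality \<kappa>"
  obtains A :: "'a set \<Rightarrow> 'a set" where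
    "\<And>X. A X \<subseteq> Field \<kappa>" "\<And>X. |A X| <o \<kappa>"
    "\<And>X \<Y> E. X \<subseteq> Field \<kappa> \<Longrightarrow> \<Y> \<subseteq> Pow (Field \<kappa>) \<Longrightarrow> countable \<Y> \<Longrightarrow> countable E \<Longrightarrow>
       A X \<subseteq> \<Union>(A ` \<Y>) \<union> E \<Longrightarrow> X \<in> \<Y>"
proof -
  note k = singular_uncountable[OF sing cf]
  have co: "Card_order \<kappa>" using k by blast
  obtain K where K: "K \<subseteq> Field \<kappa>" "cofinal K \<kappa>" "cofinality \<kappa> = |K|"
    using cofinality_cofinal[OF k(1)] .
  have K_less: "|K| <o \<kappa>" using sing singular_cardinal_iff_cofinality K(3) by metis
  define P where "P = (SIGMA a:K. Pow (underS \<kappa> a))"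
  have "|P| \<le>o \<kappa>"
    unfolding P_def
  proof (rule card_of_Sigma_ordLeq_infinite_Field[OF _ co])
    show "infinite (Field \<kappa>)" using k(1) by (simp add: cinfinite_def)
    show "|K| \<le>o \<kappa>" using K_less by (rule ordLess_imp_ordLeq)
    show "\<forall>a\<in>K. |Pow (underS \<kappa> a)| \<le>o \<kappa>"
      using strong_limit_Pow[OF lim card_of_underS[OF co]] K(1) ordLess_imp_ordLeq by blast
  qed
  then have "|P| \<le>o |Field \<kappa>|"
    by (rule ordLeq_ordIso_trans[OF _ ordIso_symmetric[OF card_of_Field_ordIso[OF co]]])
  then obtain g where g: "inj_on g P" "g ` P \<subseteq> Field \<kappa>" using card_of_ordLeq by metis
  \<comment> \<open>\<open>e X a\<close> codes the trace of \<open>X\<close> below level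
    \<open>a\<close>; since \<open>g\<close> is injective, two branches meet only at a common level
    below which their sets agree.\<close>
  define e where "e X a = g (a, X \<inter> underS \<kappa> a)" for X a
  have inP: "(a, X \<inter> underS \<kappa> a) \<in> P" if "a \<in> K" for X a using that by (auto simp: P_def)
  have e_eq: "a = b \<and> X \<inter> underS \<kappa> a = Y \<inter> underS \<kappa> b"
    if "a \<in> K" "b \<in> K" "e X a = e Y b" for X Y a b
    using inj_onD[OF g(1) _ inP inP, of a X b Y] that by (auto simp: e_def)
  have e_Field: "e X a \<in> Field \<kappa>" if "a \<in> K" for X a
    using g(2) inP[OF that] unfolding e_def by blast
  show ?thesis
  proof (rule that[of "\<lambda>X. e X ` K"])
    show "e X ` K \<subseteq> Field \<kappa>" for X using e_Field by blast
    show "|e X ` K| <o \<kappa>" for X using card_of_image K_less by (rule ordLeq_ordLess_trans)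
    fix X \<Y> E
    assume X: "X \<subseteq> Field \<kappa>" and Y: "\<Y> \<subseteq> Pow (Field \<kappa>)" "countable \<Y>" and E: "countable E"
      and cover: "e X ` K \<subseteq> \<Union>((\<lambda>X. e X ` K) ` \<Y>) \<union> E"
    show "X \<in> \<Y>"
    proof (rule ccontr)
      assume "X \<notin> \<Y>"
      then have "\<exists>x\<in>Field \<kappa>. x \<in> X \<longleftrightarrow> x \<notin> Y" if "Y \<in> \<Y>" for Y
      proof -
        have "X \<noteq> Y" using \<open>X \<notin> \<Y>\<close> that by blast
        then obtain x where "x \<in> X \<longleftrightarrow> x \<notin> Y" by blast
        moreover have "x \<in> Field \<kappa>" using calculation X Y(1) that by blast
        ultimately show ?thesis by blast
      qed
      then obtain d where d: "\<And>Y. Y \<in> \<Y> \<Longrightarrow> d Y \<in> Field \<kappa> \<and> (d Y \<in> X \<longleftrightarrow> d Y \<notin> Y)" by metis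
      \<comment> \<open>One point of difference from each \<open>Y\<close>, and the levels at which
        the branch of \<open>X\<close> runs through \<open>E\<close>. As \<open>L\<close> is
        countable, some level \<open>a\<close> in \<open>K\<close> lies beyond it; there the branch
        of \<open>X\<close> avoids \<open>E\<close> and all branches from
        \<open>\<Y>\<close>.\<close>
      define L where "L = d ` \<Y> \<union> {a \<in> K. e X a \<in> E}"
      have "inj_on (e X) {a \<in> K. e X a \<in> E}" using e_eq by (intro inj_onI) blast
      moreover have "countable (e X ` {a \<in> K. e X a \<in> E})"
        by (rule countable_subset[OF _ E]) blast
      ultimately have "countable {a \<in> K. e X a \<in> E}" using countable_image_inj_on by blast
      then have "countable L" using Y(2) unfolding L_def by blast
      moreover have "L \<subseteq> Field \<kappa>" using d K(1) unfolding L_def by blast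
      ultimately obtain b where b: "b \<in> Field \<kappa>" "L \<subseteq> underS \<kappa> b"
        using not_cofinal_bounded[OF k(1)] not_countable_cofinal[OF k(1) cf] by metis
      obtain a where a: "a \<in> K" "b \<noteq> a" "(b, a) \<in> \<kappa>" using K(2) b(1) unfolding cofinal_def by blast
      have "trans \<kappa>" "antisym \<kappa>"
        using co by (auto simp: card_order_on_def well_order_on_def linear_order_on_def
            partial_order_on_def preorder_on_def)
      then have L: "L \<subseteq> underS \<kappa> a"
        using b(2) a(2,3) unfolding underS_def trans_def antisym_def by blast
      then have "a \<notin> L" unfolding underS_def by blast
      then have "e X a \<notin> E" using a(1) unfolding L_def by blast
      then obtain Y c where Yc: "Y \<in> \<Y>" "c \<in> K" "e X a = e Y c" using cover a(1) by blast
      then have "X \<inter> underS \<kappa> a = Y \<inter> underS \<kappa> a" using e_eq[OF a(1) Yc(2,3)] by blast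
      moreover have "d Y \<in> underS \<kappa> a" using L Yc(1) unfolding L_def by blast
      ultimately show False using d[OF Yc(1)] by blast
    qed
  qed
qed

text \<open>The closed sets are the members of the ideal and the whole space.\<close>

lemma ideal_is_nowhere_dense_sets:
  assumes sub: "\<And>A B. A \<in> J \<Longrightarrow> B \<subseteq> A \<Longrightarrow> B \<in> J"
    and un: "\<And>A B. A \<in> J \<Longrightarrow> B \<in> J \<Longrightarrow> A \<union> B \<in> J"
    and J: "J \<subseteq> Pow S" "S \<notin> J" and sing: "\<And>x. x \<in> S \<Longrightarrow> {x} \<in> J" and emp: "{} \<in> J"
  shows "\<exists>\<tau>. topspace \<tau> = S \<and> t1_space \<tau> \<and> no_isolated_points \<tau> \<and> nowhere_dense_sets \<tau> = J"
proof -
  define op where "op U \<longleftrightarrow> U = {} \<or> U \<subseteq> S \<and> S - U \<in> J" for U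
  have "istopology op"
    unfolding istopology_def
  proof (intro conjI allI impI)
    fix U V assume "op U" "op V"
    then show "op (U \<inter> V)" using un by (auto simp: op_def Diff_Int)
  next
    fix \<U> assume U: "\<forall>U\<in>\<U>. op U"
    show "op (\<Union>\<U>)"
    proof (cases "\<Union>\<U> = {}")
      case False
      then obtain V where V: "V \<in> \<U>" "V \<noteq> {}" by blast
      then have "S - \<Union>\<U> \<in> J" using U sub[of "S - V" "S - \<Union>\<U>"] unfolding op_def by blast
      moreover have "\<Union>\<U> \<subseteq> S" using U unfolding op_def by blast
      ultimately show ?thesis unfolding op_def by blast
    qed (simp add: op_def)
  qed
  then have open_iff: "openin (topology op) U \<longleftrightarrow> op U" for U by simp
  have "op S" using emp unfolding op_def by simp
  have "\<Union>(Collect op) = S"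
  proof (intro equalityI Union_least)
    show "U \<subseteq> S" if "U \<in> Collect op" for U using that unfolding op_def by blast
    show "S \<subseteq> \<Union>(Collect op)" using \<open>op S\<close> by blast
  qed
  then have top: "topspace (topology op) = S" unfolding topspace_def open_iff .
  have closed_iff: "closedin (topology op) C \<longleftrightarrow> C = S \<or> C \<in> J" for C
  proof (cases "C \<subseteq> S")
    case True
    then have "S - (S - C) = C" "S - C = {} \<longleftrightarrow> C = S" by blast+
    then show ?thesis using True unfolding closedin_def top open_iff by (simp add: op_def Diff_subset)
  next
    case False
    then show ?thesis using J(1) unfolding closedin_def top by blast
  qed
  have nd: "nowhere_dense_sets (topology op) = J"
  proof (intro equalityI subsetI)
    fix N assume "N \<in> nowhere_dense_sets (topology op)"
    then have N: "N \<subseteq> S" "topology op interior_of (topology op closure_of N) = {}"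
      unfolding nowhere_dense_sets_def top by auto
    \<comment> \<open>If the closure were the whole space, so would be its interior, and
      \<open>S\<close> is nonempty because \<open>{}\<close> is in \<open>J\<close> and
      \<open>S\<close> is not.\<close>
    have "topology op closure_of N \<noteq> S" using N(2) interior_of_topspace[of "topology op"] top emp J(2)
      by auto
    then have "topology op closure_of N \<in> J" using closed_iff closedin_closure_of by blast
    moreover have "N \<subseteq> topology op closure_of N" using N(1) top by (simp add: closure_of_subset)
    ultimately show "N \<in> J" by (rule sub)
  next
    fix N assume N: "N \<in> J"
    then have cl: "topology op closure_of N = N" using closed_iff by (simp add: closure_of_eq)
    \<comment> \<open>A nonempty open part of \<open>N\<close> and its complement would both lie in
      \<open>J\<close>, and hence so would their union \<open>S\<close>.\<close>
    have "topology op interior_of N = {}"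
    proof (rule ccontr)
      let ?U = "topology op interior_of N"
      assume "?U \<noteq> {}"
      moreover have "op ?U" using open_iff openin_interior_of by blast
      ultimately have "S - ?U \<in> J" unfolding op_def by blast
      moreover have "?U \<in> J" using sub[OF N interior_of_subset] .
      ultimately have "S - ?U \<union> ?U \<in> J" by (rule un)
      moreover have "?U \<subseteq> S" using interior_of_subset_topspace top by metis
      then have "S - ?U \<union> ?U = S" by blast
      ultimately show False using J(2) by simp
    qed
    then show "N \<in> nowhere_dense_sets (topology op)"
      using N J(1) top cl unfolding nowhere_dense_sets_def by auto
  qed
  have "t1_space (topology op)" using sing top closed_iff by (simp add: t1_space_closedin_singleton)
  moreover have "no_isolated_points (topology op)"
    unfolding no_isolated_points_def top open_iff op_def
  proof (intro ballI notI)
    fix x assume x: "x \<in> S" "{x} = {} \<or> {x} \<subseteq> S \<and> S - {x} \<in> J"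
    then have "S - {x} \<union> {x} \<in> J" using un sing by blast
    moreover have "S - {x} \<union> {x} = S" using x(1) by blast
    ultimately show False using J(2) by simp
  qed
  ultimately show ?thesis using top nd by blast
qed

text \<open>The members of the ideal are smaller than \<kappa>, so the whole space is not among
  them. Almost disjointness lets a countable union contain only countably many generating branches,
  as \<open>no_winning_coding_strategy\<close> demands.\<close>

lemma no_winning_coding_strategy_if_infinitely_many:
  fixes \<kappa> :: "'a rel"
  assumes sing: "singular_cardinal \<kappa>" and lim: "strong_limit_cardinal \<kappa>"
    and cf: "natLeq <o cofinality \<kappa>"
    and inf: "\<not> finitely_many_cardinals_between_power \<kappa>"
  obtains \<tau> where "topspace \<tau> = Field \<kappa>" "t1_space \<tau>" "no_isolated_points \<tau>"
    "\<And>F. \<not> winning_coding_strategy (nowhere_dense_sets \<tau>) F"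
proof -
  note k = singular_uncountable[OF sing cf]
  have co: "Card_order \<kappa>" using k by blast
  have kF: "\<kappa> =o |Field \<kappa>|" "|Field \<kappa>| =o \<kappa>"
    using card_of_Field_ordIso[OF co] by (simp_all add: ordIso_symmetric)
  let ?C = "cardinals_between_power \<kappa>"
  have C_co: "Card_order c" "\<kappa> <o c" "c <o ctwo ^c \<kappa>" if "c \<in> ?C" for c
    using that unfolding cardinals_between_power_def by blast+
  have "Well_order c" if "c \<in> ?C" for c
    using C_co(1)[OF that] by (simp add: card_order_on_def)
  then obtain l where l: "\<And>n. l n \<in> ?C" "\<And>n. l n <o l (Suc n)"
    using increasing_cardinals[of ?C] inf unfolding finitely_many_cardinals_between_power_def
    by metis
  \<comment> \<open>The cardinals are copied into \<open>Pow (Field \<kappa>)\<close> so that their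
    elements can serve as the sets \<open>X\<close> indexing the branches
    \<open>A X\<close>.\<close>
  have "\<exists>I\<subseteq>Pow (Field \<kappa>). l n =o |I|" for n
  proof -
    have "|Field (l n)| =o l n" by (rule card_of_Field_ordIso[OF C_co(1)[OF l(1)]])
    also have "l n \<le>o ctwo ^c \<kappa>" using C_co(3)[OF l(1)] by (rule ordLess_imp_ordLeq)
    also have "ctwo ^c \<kappa> =o |Pow (Field \<kappa>)|"
      unfolding cexp_def ctwo_def Field_card_of by (rule ordIso_symmetric[OF card_of_Pow_Func])
    finally have "\<exists>I\<subseteq>Pow (Field \<kappa>). |Field (l n)| =o |I| \<and> |I| \<le>o |Pow (Field \<kappa>)|"
      by (rule iffD1[OF internalize_card_of_ordLeq2])
    then obtain I where I: "I \<subseteq> Pow (Field \<kappa>)" "|Field (l n)| =o |I|" by auto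
    have "l n =o |I|"
      by (rule ordIso_transitive[OF ordIso_symmetric[OF card_of_Field_ordIso[OF C_co(1)[OF l(1)]]] I(2)])
    then show ?thesis using I(1) by blast
  qed
  then obtain I where I: "\<And>n. I n \<subseteq> Pow (Field \<kappa>)" "\<And>n. l n =o |I n|" by metis
  have less: "|I n| <o |I (Suc n)|" for n
    by (rule ordIso_ordLess_trans[OF ordIso_symmetric[OF I(2)] ordLess_ordIso_trans[OF l(2) I(2)]])
  have k_le: "\<kappa> \<le>o |I n|" for n
    by (rule ordLess_imp_ordLeq[OF ordLess_ordIso_trans[OF C_co(2)[OF l(1)] I(2)]])
  have I_inf: "infinite (I n)" for n
    using cinfinite_mono[OF k_le] k(1) by (simp add: cinfinite_def Field_card_of)
  let ?U = "\<Union>(range I)"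
  have U: "?U \<subseteq> Pow (Field \<kappa>)" using I(1) by blast
  have k_le_U: "\<kappa> \<le>o |?U|"
    by (rule ordLeq_transitive[OF k_le[of 0] card_of_mono1]) blast
  have cU: "Cinfinite |?U|" using cinfinite_mono[OF k_le_U] k(1) card_of_Card_order by blast
  obtain A :: "'a set \<Rightarrow> 'a set" where A: "\<And>X. A X \<subseteq> Field \<kappa>" "\<And>X. |A X| <o \<kappa>"
    "\<And>X \<Y> E. X \<subseteq> Field \<kappa> \<Longrightarrow> \<Y> \<subseteq> Pow (Field \<kappa>) \<Longrightarrow> countable \<Y> \<Longrightarrow> countable E \<Longrightarrow>
       A X \<subseteq> \<Union>(A ` \<Y>) \<union> E \<Longrightarrow> X \<in> \<Y>"
    using almost_disjoint_branches[OF sing lim cf] by metis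
  define G where "G \<F> E = \<Union>(A ` \<F>) \<union> E" for \<F> E
  define J where "J = (\<Union>(\<F>, E)\<in>Fpow ?U \<times> Fpow (Field \<kappa>). Pow (G \<F> E))"
  have J_iff: "B \<in> J \<longleftrightarrow>
    (\<exists>\<F> E. finite \<F> \<and> \<F> \<subseteq> ?U \<and> finite E \<and> E \<subseteq> Field \<kappa> \<and> B \<subseteq> G \<F> E)" for B
    unfolding J_def Fpow_def by blast
  have G_less: "|G \<F> E| <o \<kappa>" if "finite \<F>" "finite E" for \<F> E
    unfolding G_def
  proof (rule Un_Cinfinite_bound_strict[OF finite_UN_ordLess _ k(1)])
    show "|E| <o \<kappa>"
      using that(2) k(1) by (intro Cfinite_ordLess_Cinfinite)
        (auto simp: cfinite_def Field_card_of card_of_card_order_on)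
  qed (use that A(2) k(1) in auto)
  have J_sub: "B \<in> J" if "A \<in> J" "B \<subseteq> A" for A B
    using that unfolding J_iff by blast
  have J_un: "B \<union> B' \<in> J" if B: "B \<in> J" "B' \<in> J" for B B'
  proof -
    obtain \<F> E \<F>' E' where
      *: "finite \<F>" "\<F> \<subseteq> ?U" "finite E" "E \<subseteq> Field \<kappa>" "B \<subseteq> G \<F> E"
         "finite \<F>'" "\<F>' \<subseteq> ?U" "finite E'" "E' \<subseteq> Field \<kappa>" "B' \<subseteq> G \<F>' E'"
      using B unfolding J_iff by metis
    then have "B \<union> B' \<subseteq> G (\<F> \<union> \<F>') (E \<union> E')" unfolding G_def by blast
    then show ?thesis unfolding J_iff using * by (metis finite_UnI Un_least)
  qed
  have G_J: "G \<F> E \<in> J" if "finite \<F>" "\<F> \<subseteq> ?U" "finite E" "E \<subseteq> Field \<kappa>" for \<F> E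
    unfolding J_iff using that by blast
  have emp: "{} \<in> J" using G_J[of "{}" "{}"] by (simp add: G_def)
  have sing_J: "{x} \<in> J" if "x \<in> Field \<kappa>" for x using G_J[of "{}" "{x}"] that by (simp add: G_def)
  have A_J: "A X \<in> J" if "X \<in> I n" for n X using G_J[of "{X}" "{}"] that by (auto simp: G_def)
  have J_Pow: "J \<subseteq> Pow (Field \<kappa>)" unfolding J_def Fpow_def G_def using A(1) by blast
  have "Field \<kappa> \<notin> J"
  proof
    assume "Field \<kappa> \<in> J"
    then obtain \<F> E where "finite \<F>" "finite E" "Field \<kappa> \<subseteq> G \<F> E" unfolding J_iff by blast
    then have "|Field \<kappa>| <o \<kappa>" using ordLeq_ordLess_trans[OF card_of_mono1 G_less] by blast
    then show False using kF(2) by (rule notE[OF not_ordLess_ordIso])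
  qed
  then have "\<exists>\<tau>. topspace \<tau> = Field \<kappa> \<and> t1_space \<tau> \<and> no_isolated_points \<tau> \<and>
      nowhere_dense_sets \<tau> = J"
    by (rule ideal_is_nowhere_dense_sets[OF _ _ J_Pow _ _ emp, rotated 2])
      (fact sing_J, fact J_sub, fact J_un)
  then obtain \<tau> where \<tau>: "topspace \<tau> = Field \<kappa>" "t1_space \<tau>" "no_isolated_points \<tau>"
      "nowhere_dense_sets \<tau> = J"
    by blast
  \<comment> \<open>There are at most \<open>|?U|\<close> pairs of finite sets, and each
    \<open>G \<F> E\<close> has fewer than \<kappa> subsets since \<kappa> is a strong
    limit.\<close>
  have "|J| \<le>o |?U|"
    unfolding J_def
  proof (rule UNION_Cinfinite_bound[OF _ _ cU])
    have "|Fpow (Field \<kappa>)| \<le>o |Field \<kappa>|"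
      using k(1) by (intro card_of_Fpow_infinite) (simp add: cinfinite_def)
    also have "|Field \<kappa>| =o \<kappa>" by (rule kF(2))
    also note k_le_U
    finally have "|Fpow (Field \<kappa>)| \<le>o |?U|" .
    moreover have "|Fpow ?U| \<le>o |?U|"
      using cU by (intro card_of_Fpow_infinite) (simp add: cinfinite_def Field_card_of)
    ultimately show "|Fpow ?U \<times> Fpow (Field \<kappa>)| \<le>o |?U|"
      using cU by (intro card_of_Times_ordLeq_infinite_Field) (auto simp: cinfinite_def)
    have "|Pow (G \<F> E)| \<le>o |?U|" if "finite \<F>" "finite E" for \<F> E
      using ordLess_imp_ordLeq[OF strong_limit_Pow[OF lim G_less[OF that]]] k_le_U
      by (rule ordLeq_transitive)
    then show "\<forall>p\<in>Fpow ?U \<times> Fpow (Field \<kappa>). |case p of (\<F>, E) \<Rightarrow> Pow (G \<F> E)| \<le>o |?U|"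
      unfolding Fpow_def by auto
  qed
  moreover have "countable {X \<in> ?U. A X \<subseteq> D}" if D: "D \<in> countable_unions J" for D
  proof -
    obtain \<C> where C: "countable \<C>" "\<C> \<subseteq> J" "D = \<Union>\<C>"
      using D unfolding countable_unions_def by blast
    have "\<exists>\<F> E. finite \<F> \<and> \<F> \<subseteq> ?U \<and> finite E \<and> B \<subseteq> G \<F> E" if "B \<in> \<C>" for B
    proof -
      have "B \<in> J" using that C(2) by blast
      then show ?thesis unfolding J_iff by blast
    qed
    then obtain f e where
      fe: "\<And>B. B \<in> \<C> \<Longrightarrow> finite (f B) \<and> f B \<subseteq> ?U \<and> finite (e B) \<and> B \<subseteq> G (f B) (e B)" by metis
    \<comment> \<open>Countably many members of \<open>J\<close> involve only countably many
      branches and points, so a branch inside \<open>D\<close> must be one of these.\<close>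
    have ctbl: "countable (\<Union>(f ` \<C>))" "countable (\<Union>(e ` \<C>))"
      using fe C(1) by (simp_all add: countable_UN countable_finite)
    have cover: "D \<subseteq> \<Union>(A ` \<Union>(f ` \<C>)) \<union> \<Union>(e ` \<C>)"
    proof
      fix x assume "x \<in> D"
      then obtain B where B: "B \<in> \<C>" "x \<in> B" using C(3) by blast
      then have "x \<in> \<Union>(A ` f B) \<union> e B" using fe[OF B(1)] unfolding G_def by blast
      then show "x \<in> \<Union>(A ` \<Union>(f ` \<C>)) \<union> \<Union>(e ` \<C>)" using B(1) by blast
    qed
    have Pow: "\<Union>(f ` \<C>) \<subseteq> Pow (Field \<kappa>)"
    proof (rule UN_least)
      show "f B \<subseteq> Pow (Field \<kappa>)" if "B \<in> \<C>" for B
        using fe[OF that] U by (meson subset_trans)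
    qed
    have "X \<in> \<Union>(f ` \<C>)" if "X \<in> ?U" "A X \<subseteq> D" for X
    proof (rule A(3)[OF _ _ ctbl])
      show "X \<subseteq> Field \<kappa>" using U that(1) by blast
      show "A X \<subseteq> \<Union>(A ` \<Union>(f ` \<C>)) \<union> \<Union>(e ` \<C>)"
        using that(2) cover by (rule subset_trans)
    qed (rule Pow)
    then have "{X \<in> ?U. A X \<subseteq> D} \<subseteq> \<Union>(f ` \<C>)" by blast
    then show ?thesis using ctbl(1) by (rule countable_subset)
  qed
  ultimately have "\<not> winning_coding_strategy J F" for F
    by (intro no_winning_coding_strategy[of J I A] emp A_J I_inf less)
  then show ?thesis using that[OF \<tau>(1-3)] \<tau>(4) by simp
qed

text \<open>The equivalence holds cardinal by cardinal: finiteness at \<kappa> serves every space on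
  \<kappa>, and its failure at \<kappa> yields a bad space on the same \<kappa>.\<close>

theorem theorem2:
  shows "(\<forall>\<kappa> :: 'a rel.
            singular_cardinal \<kappa> \<and> natLeq <o cofinality \<kappa> \<longrightarrow>
            strong_limit_cardinal \<kappa> \<longrightarrow> finitely_many_cardinals_between_power \<kappa>)
         \<longleftrightarrow>
         (\<forall>\<kappa> :: 'a rel.
            singular_cardinal \<kappa> \<and> strong_limit_cardinal \<kappa> \<and> natLeq <o cofinality \<kappa> \<longrightarrow>
            (\<forall>\<tau> :: 'a topology.
               topspace \<tau> = Field \<kappa> \<and> t1_space \<tau> \<and> no_isolated_points \<tau> \<longrightarrow>
               (\<exists>F. winning_coding_strategy (nowhere_dense_sets \<tau>) F)))"
proof (intro iffI allI impI)
  fix \<kappa> :: "'a rel" and \<tau> :: "'a topology"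
  assume "\<forall>\<kappa> :: 'a rel. singular_cardinal \<kappa> \<and> natLeq <o cofinality \<kappa> \<longrightarrow>
      strong_limit_cardinal \<kappa> \<longrightarrow> finitely_many_cardinals_between_power \<kappa>"
    and "singular_cardinal \<kappa> \<and> strong_limit_cardinal \<kappa> \<and> natLeq <o cofinality \<kappa>"
    and "topspace \<tau> = Field \<kappa> \<and> t1_space \<tau> \<and> no_isolated_points \<tau>"
  then show "\<exists>F. winning_coding_strategy (nowhere_dense_sets \<tau>) F"
    by (intro winning_coding_strategy_if_finitely_many[of \<kappa>]) simp_all
next
  fix \<kappa> :: "'a rel"
  assume win: "\<forall>\<kappa> :: 'a rel.
      singular_cardinal \<kappa> \<and> strong_limit_cardinal \<kappa> \<and> natLeq <o cofinality \<kappa> \<longrightarrow>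
      (\<forall>\<tau> :: 'a topology. topspace \<tau> = Field \<kappa> \<and> t1_space \<tau> \<and> no_isolated_points \<tau> \<longrightarrow>
        (\<exists>F. winning_coding_strategy (nowhere_dense_sets \<tau>) F))"
    and \<kappa>: "singular_cardinal \<kappa> \<and> natLeq <o cofinality \<kappa>" "strong_limit_cardinal \<kappa>"
  show "finitely_many_cardinals_between_power \<kappa>"
  proof (rule ccontr)
    assume "\<not> finitely_many_cardinals_between_power \<kappa>"
    with \<kappa> obtain \<tau> where "topspace \<tau> = Field \<kappa>" "t1_space \<tau>" "no_isolated_points \<tau>"
      "\<And>F. \<not> winning_coding_strategy (nowhere_dense_sets \<tau>) F"
      using no_winning_coding_strategy_if_infinitely_many[of \<kappa>] by metis
    then show False using spec[OF win, of \<kappa>] \<kappa> by blast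
  qed
qed

end
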